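(* Let $\mathcal{M}$ be a matroid of rank $r$, and for $0\leq j\leq r$ let $I_j(\mathcal{M})$ be the number of $j$-element independent sets of $\mathcal{M}$. Assume that for infinitely many integers $\ell\geq1$ the matroid $T_r(\mathcal{M}\oplus\mathcal{U}_{\ell,\ell})$ satisfies $\sqrt{\mathrm{BLC}}[\ell]$. Then $I_j(\mathcal{M})^2\geq I_{j-1}(\mathcal{M})\,I_{j+1}(\mathcal{M})$ for all $1\leq j\leq r-1$.
   Context: $\mathcal{M}\oplus\mathcal{U}_{\ell,\ell}$ denotes the direct sum of $\mathcal{M}$ with the free matroid on $\ell$ new elements (all of which are coloops), and $T_r(\cdot)$ denotes truncation to rank $r$ (the matroid whose bases are the $r$-element independent sets). For a matroid $\mathcal{L}$ on a finite ground set $E$ (identified with its set of bases), positive real weights $\mathbf{y}=(y_e)_{e\in E}$ (written $\mathbf{y}>\mathbf{0}$), $\mathbf{y}^A=\prod_{e\in A}y_e$, $S\subseteq E$ and integer $j$, let $L_j(S,\mathbf{y})=\sum\mathbf{y}^B$ over all bases $B$ of $\mathcal{L}$ with $|B\cap S|=j$. $\mathcal{L}$ satisfies $\sqrt{\mathrm{BLC}}[m]$ if for all $\mathbf{y}>\mathbf{0}$, all $S\subseteq E$ with $|S|=n\leq m$ and all $1\leq j\leq n-1$, whenever $L_j(S,\mathbf{y})\neq0$ we have $L_j(S,\mathbf{y})^2>\bigl[1+\frac{1}{\min(j,n-j)}\bigr]L_{j-1}(S,\mathbf{y})L_{j+1}(S,\mathbf{y})$. *)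

theory Defs
  imports Complex_Main
begin

text \<open>
  A matroid is given by its finite ground set and its set of bases.
\<close>

locale matroid =
  fixes E :: "'a set" and \<B> :: "'a set set"
  assumes finite_ground: "finite E"
    and bases_subset: "B \<in> \<B> \<Longrightarrow> B \<subseteq> E"
    and bases_nonempty: "\<B> \<noteq> {}"
    and basis_exchange:
      "A \<in> \<B> \<Longrightarrow> B \<in> \<B> \<Longrightarrow> a \<in> A - B \<Longrightarrow> \<exists>b\<in>B - A. insert b (A - {a}) \<in> \<B>"

definition indep :: "'a set set \<Rightarrow> 'a set \<Rightarrow> bool" where
  "indep \<B> X \<longleftrightarrow> (\<exists>B\<in>\<B>. X \<subseteq> B)"

text \<open>All bases have the same size (see \<open>matroid.card_basis\<close>), so the maximum is attained at each of them.\<close>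

definition matroid_rank :: "'a set set \<Rightarrow> nat" where
  "matroid_rank \<B> = Max (card ` \<B>)"

definition num_indep :: "'a set set \<Rightarrow> nat \<Rightarrow> nat" where
  "num_indep \<B> j = card {X. indep \<B> X \<and> card X = j}"

definition uniform_bases :: "nat \<Rightarrow> 'a set \<Rightarrow> 'a set set" where
  "uniform_bases k A = {X. X \<subseteq> A \<and> card X = k}"

text \<open>The direct sum lives on the disjoint union \<open>E <+> F\<close> of the two ground sets.\<close>

definition direct_sum :: "'a set set \<Rightarrow> 'b set set \<Rightarrow> ('a + 'b) set set" where
  "direct_sum \<B> \<C> = {A <+> B | A B. A \<in> \<B> \<and> B \<in> \<C>}"

definition truncation :: "nat \<Rightarrow> 'a set set \<Rightarrow> 'a set set" where
  "truncation r \<B> = {X. indep \<B> X \<and> card X = r}"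

definition level_poly :: "'a set set \<Rightarrow> nat \<Rightarrow> 'a set \<Rightarrow> ('a \<Rightarrow> real) \<Rightarrow> real" where
  "level_poly \<B> j S y = (\<Sum>B | B \<in> \<B> \<and> card (B \<inter> S) = j. \<Prod>e\<in>B. y e)"

definition sqrt_BLC :: "'a set \<Rightarrow> 'a set set \<Rightarrow> nat \<Rightarrow> bool" where
  "sqrt_BLC E \<B> m \<longleftrightarrow>
     (\<forall>y. (\<forall>e\<in>E. y e > 0) \<longrightarrow>
       (\<forall>S\<subseteq>E. card S \<le> m \<longrightarrow>
         (\<forall>j\<in>{1..card S - 1}. level_poly \<B> j S y \<noteq> 0 \<longrightarrow>
           (level_poly \<B> j S y)\<^sup>2 >
             (1 + 1 / real (min j (card S - j))) *
               level_poly \<B> (j - 1) S y * level_poly \<B> (j + 1) S y)))"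

context matroid
begin

lemma finite_basis: "B \<in> \<B> \<Longrightarrow> finite B"
  using bases_subset finite_ground finite_subset by blast

lemma finite_bases: "finite \<B>"
  using bases_subset finite_ground by (meson PowI finite_Pow_iff finite_subset subsetI)

lemma card_basis_le:
  assumes "A \<in> \<B>" "B \<in> \<B>"
  shows "card A \<le> card B"
  using assms
proof (induction "card (A - B)" arbitrary: A)
  case 0
  then have "A \<subseteq> B" using finite_basis by auto
  then show ?case using 0 finite_basis by (simp add: card_mono)
next
  case (Suc n)
  then obtain a where a: "a \<in> A - B" by (metis card.empty equals0I nat.distinct(1))
  then obtain b where b: "b \<in> B - A" "insert b (A - {a}) \<in> \<B>"
    using basis_exchange Suc by blast
  have fin: "finite A" using Suc finite_basis by blast
  have "insert b (A - {a}) - B = (A - B) - {a}" using b by auto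
  then have "n = card (insert b (A - {a}) - B)" using Suc.hyps(2) a fin by simp
  then have "card (insert b (A - {a})) \<le> card B" using Suc.hyps(1) b Suc.prems by blast
  moreover have "card (insert b (A - {a})) = card A"
    using a b fin by (metis DiffD1 DiffD2 card_Suc_Diff1 card_insert_disjoint finite_Diff)
  ultimately show ?case by simp
qed

lemma card_basis: "B \<in> \<B> \<Longrightarrow> card B = matroid_rank \<B>"
proof -
  assume B: "B \<in> \<B>"
  have "card ` \<B> = {card B}" using B card_basis_le by (auto intro: le_antisym)
  then show ?thesis unfolding matroid_rank_def by simp
qed

lemma augment:
  assumes X: "indep \<B> X" and Y: "indep \<B> Y" and lt: "card X < card Y"
  shows "\<exists>e\<in>Y - X. indep \<B> (insert e X)"
proof (rule ccontr)
  assume no: "\<not> ?thesis"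
  obtain B where B: "B \<in> \<B>" "Y \<subseteq> B" using Y unfolding indep_def by blast
  have main: "\<not> (A \<in> \<B> \<and> X \<subseteq> A)" for A
  proof (induction "card (A - X - B)" arbitrary: A rule: less_induct)
    case less
    show ?case
    proof
      assume A: "A \<in> \<B> \<and> X \<subseteq> A"
      have fin: "finite A" "finite B" using A B finite_basis by auto
      show False
      proof (cases "A - X - B = {}")
        case True
        have "A \<inter> (Y - X) = {}" using no A unfolding indep_def by auto
        then have sub: "A - X \<subseteq> B - Y" using True by auto
        have "card A - card X = card (A - X)"
          using A fin by (metis card_Diff_subset finite_subset)
        also have "\<dots> \<le> card (B - Y)" using sub fin by (simp add: card_mono)
        also have "\<dots> = card B - card Y"
          using B fin by (metis card_Diff_subset finite_subset)
        finally have "card A - card X \<le> card B - card Y" .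
        moreover have "card A = card B" using A B card_basis by metis
        moreover have "card Y \<le> card B" using B fin card_mono by blast
        ultimately show False using lt by linarith
      next
        case False
        then obtain a where a: "a \<in> A - X - B" by blast
        then obtain b where b: "b \<in> B - A" "insert b (A - {a}) \<in> \<B>"
          using basis_exchange A B by blast
        have "insert b (A - {a}) - X - B = (A - X - B) - {a}" using b by auto
        then have "card (insert b (A - {a}) - X - B) < card (A - X - B)"
          using a fin by (metis card_Diff1_less finite_Diff)
        then show False using less b A a by blast
      qed
    qed
  qed
  show False using main X unfolding indep_def by blast
qed

lemma matroid_truncation:
  assumes "r \<le> matroid_rank \<B>"
  shows "matroid E (truncation r \<B>)"
proof
  show "finite E" by (rule finite_ground)
  show "B \<subseteq> E" if "B \<in> truncation r \<B>" for B
    using that bases_subset unfolding truncation_def indep_def by blast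
  obtain B where B: "B \<in> \<B>" using bases_nonempty by blast
  then obtain X where "X \<subseteq> B" "card X = r"
    using assms card_basis obtain_subset_with_card_n by metis
  then show "truncation r \<B> \<noteq> {}" using B unfolding truncation_def indep_def by blast
next
  fix A B a
  assume A: "A \<in> truncation r \<B>" and B: "B \<in> truncation r \<B>" and a: "a \<in> A - B"
  have fin: "finite A"
    using A finite_basis finite_subset unfolding truncation_def indep_def by blast
  have ind: "indep \<B> (A - {a})" using A unfolding truncation_def indep_def by blast
  have lt: "card (A - {a}) < card B"
    using A B a fin unfolding truncation_def by (metis (mono_tags, lifting) DiffD1 card_Diff1_less mem_Collect_eq)
  obtain b where b: "b \<in> B - (A - {a})" "indep \<B> (insert b (A - {a}))"
    using augment[OF ind _ lt] B unfolding truncation_def by blast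
  have bA: "b \<in> B - A" using b a by auto
  have "card (insert b (A - {a})) = card A"
    using a bA fin by (metis DiffD1 DiffD2 card_Suc_Diff1 card_insert_disjoint finite_Diff)
  then show "\<exists>b\<in>B - A. insert b (A - {a}) \<in> truncation r \<B>"
    using A bA b(2) unfolding truncation_def by auto
qed

end

lemma uniform_bases_free: "finite A \<Longrightarrow> uniform_bases (card A) A = {A}"
  unfolding uniform_bases_def using card_subset_eq by blast

lemma matroid_free: "finite A \<Longrightarrow> matroid A {A}"
  by unfold_locales auto

lemma matroid_direct_sum:
  assumes "matroid E \<B>" and "matroid F \<C>"
  shows "matroid (E <+> F) (direct_sum \<B> \<C>)"
proof -
  interpret M: matroid E \<B> by fact
  interpret N: matroid F \<C> by fact
  show ?thesis
  proof
    show "finite (E <+> F)" using M.finite_ground N.finite_ground by simp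
    show "B \<subseteq> E <+> F" if "B \<in> direct_sum \<B> \<C>" for B
      using that M.bases_subset N.bases_subset unfolding direct_sum_def by blast
    show "direct_sum \<B> \<C> \<noteq> {}"
      using M.bases_nonempty N.bases_nonempty unfolding direct_sum_def by blast
  next
    fix A B a
    assume "A \<in> direct_sum \<B> \<C>" "B \<in> direct_sum \<B> \<C>" and a: "a \<in> A - B"
    then obtain A1 A2 B1 B2 where
      AB: "A = A1 <+> A2" "B = B1 <+> B2" "A1 \<in> \<B>" "B1 \<in> \<B>" "A2 \<in> \<C>" "B2 \<in> \<C>"
      unfolding direct_sum_def by blast
    show "\<exists>b\<in>B - A. insert b (A - {a}) \<in> direct_sum \<B> \<C>"
    proof (cases a)
      case (Inl x)
      then obtain b where b: "b \<in> B1 - A1" "insert b (A1 - {x}) \<in> \<B>"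
        using M.basis_exchange[of A1 B1 x] a AB by auto
      have "insert (Inl b) (A - {a}) = insert b (A1 - {x}) <+> A2"
        using AB Inl by auto
      then show ?thesis using b AB unfolding direct_sum_def
        by (intro bexI[of _ "Inl b"]) auto
    next
      case (Inr x)
      then obtain b where b: "b \<in> B2 - A2" "insert b (A2 - {x}) \<in> \<C>"
        using N.basis_exchange[of A2 B2 x] a AB by auto
      have "insert (Inr b) (A - {a}) = A1 <+> insert b (A2 - {x})"
        using AB Inr by auto
      then show ?thesis using b AB unfolding direct_sum_def
        by (intro bexI[of _ "Inr b"]) auto
    qed
  qed
qed

end

theory Submission
  imports Defs
begin

text \<open>
  Take all weights equal to \<open>1\<close> and let \<open>S\<close> be the set of the \<open>l\<close> new elements. With \<open>k = r - j\<close>,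
  the level polynomials at \<open>k\<close> and \<open>k \<plusminus> 1\<close> are the products of \<open>I\<^sub>j\<close> and \<open>I\<^sub>j\<^sub>\<mp>\<^sub>1\<close> with the binomial
  coefficients \<open>l choose k\<close> and \<open>l choose (k \<plusminus> 1)\<close>. The ratio of the latter is
  \<open>(1 + 1/k) (1 + 1/(l-k))\<close>, whose first factor is cancelled by the constant of the hypothesis once
  \<open>l \<ge> 2 k\<close>. There remains \<open>I\<^sub>j\<^sup>2 (1 + 1/(l-k)) > I\<^sub>j\<^sub>-\<^sub>1 I\<^sub>j\<^sub>+\<^sub>1\<close>, and because both sides involve
  integers it is enough that \<open>l - k \<ge> I\<^sub>j\<^sup>2\<close>.
\<close>

text \<open>This supplies the preimages that make the counting map \<open>(X, Y)\<close> to
  \<open>X <+> Y\<close> below surjective.\<close>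

lemma Plus_vimage: "Inl -` Z <+> Inr -` Z = Z"
proof (rule set_eqI)
  fix z show "z \<in> Inl -` Z <+> Inr -` Z \<longleftrightarrow> z \<in> Z" by (cases z) auto
qed

lemma Plus_subset_iff: "X <+> Y \<subseteq> A <+> B \<longleftrightarrow> X \<subseteq> A \<and> Y \<subseteq> B"
  by auto

lemma Plus_eq_iff: "X <+> Y = A <+> B \<longleftrightarrow> X = A \<and> Y = B"
  unfolding set_eq_subset Plus_subset_iff by (simp only: conj_ac)

lemma indep_direct_sum:
  "indep (direct_sum \<B> \<C>) (X <+> Y) \<longleftrightarrow> indep \<B> X \<and> indep \<C> Y"
proof
  assume "indep (direct_sum \<B> \<C>) (X <+> Y)"
  then obtain A B where "A \<in> \<B>" "B \<in> \<C>" "X <+> Y \<subseteq> A <+> B"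
    unfolding indep_def direct_sum_def by blast
  then show "indep \<B> X \<and> indep \<C> Y" unfolding Plus_subset_iff indep_def by blast
next
  assume "indep \<B> X \<and> indep \<C> Y"
  then obtain A B where "A \<in> \<B>" "X \<subseteq> A" "B \<in> \<C>" "Y \<subseteq> B" unfolding indep_def by blast
  then have "A <+> B \<in> direct_sum \<B> \<C>" "X <+> Y \<subseteq> A <+> B"
    unfolding direct_sum_def Plus_subset_iff by auto
  then show "indep (direct_sum \<B> \<C>) (X <+> Y)" unfolding indep_def by blast
qed

lemma (in matroid) finite_indep: "indep \<B> X \<Longrightarrow> finite X"
  using finite_basis finite_subset unfolding indep_def by blast

text \<open>Needed for the premise of \<open>sqrt_BLC\<close> that the middle level polynomial is
  nonzero.\<close>

lemma (in matroid) num_indep_pos: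
  assumes "j \<le> matroid_rank \<B>"
  shows "num_indep \<B> j > 0"
proof -
  obtain B where B: "B \<in> \<B>" using bases_nonempty by blast
  then obtain X where X: "X \<subseteq> B" "card X = j"
    using assms card_basis obtain_subset_with_card_n by metis
  have "{X. indep \<B> X \<and> card X = j} \<subseteq> Pow E"
    using bases_subset unfolding indep_def by blast
  then have "finite {X. indep \<B> X \<and> card X = j}"
    using finite_ground by (meson finite_Pow_iff finite_subset)
  then show ?thesis
    using B X unfolding num_indep_def card_gt_0_iff indep_def by blast
qed

text \<open>With unit weights the level polynomial counts bases. Each is uniquely
  \<open>X <+> Y\<close> with \<open>X\<close> independent and \<open>Y\<close> an arbitrary subset
  of \<open>F\<close>; fixing \<open>card Y = k\<close> forces
  \<open>card X = r - k\<close>.\<close>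

lemma (in matroid) level_poly_truncation_direct_sum_free:
  fixes F :: "'b set"
  assumes F: "finite F" and k: "k \<le> r"
  shows "level_poly (truncation r (direct_sum \<B> {F})) k (Inr ` F) (\<lambda>_. 1) =
    real (num_indep \<B> (r - k) * (card F choose k))"
proof -
  let ?I = "{X. indep \<B> X \<and> card X = r - k}"
  let ?K = "{Y. Y \<subseteq> F \<and> card Y = k}"
  let ?L = "{Z \<in> truncation r (direct_sum \<B> {F}). card (Z \<inter> Inr ` F) = k}"
  have free: "indep {F} Y \<longleftrightarrow> Y \<subseteq> F" for Y by (simp add: indep_def)
  have mem: "X <+> Y \<in> ?L \<longleftrightarrow> X \<in> ?I \<and> Y \<in> ?K" for X Y
  proof (cases "indep \<B> X \<and> Y \<subseteq> F")
    case True
    then have fin: "finite X" "finite Y" using finite_indep F finite_subset by auto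
    have "(X <+> Y) \<inter> Inr ` F = Inr ` Y" using True by auto
    then have "card ((X <+> Y) \<inter> Inr ` F) = card Y" by (simp add: card_image)
    moreover have "card (X <+> Y) = card X + card Y" using fin by (rule card_Plus)
    ultimately show ?thesis
      using True k by (auto simp: truncation_def indep_direct_sum free)
  next
    case False
    then show ?thesis by (auto simp: truncation_def indep_direct_sum free)
  qed
  have "bij_betw (\<lambda>(X, Y). X <+> Y) (?I \<times> ?K) ?L"
  proof (rule bij_betwI')
    fix p q :: "'a set \<times> 'b set"
    show "(case p of (X, Y) \<Rightarrow> X <+> Y) = (case q of (X, Y) \<Rightarrow> X <+> Y) \<longleftrightarrow> p = q"
      by (cases p, cases q) (simp add: Plus_eq_iff)
  next
    fix p assume "p \<in> ?I \<times> ?K"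
    then show "(case p of (X, Y) \<Rightarrow> X <+> Y) \<in> ?L"
      unfolding mem_Times_iff case_prod_unfold mem .
  next
    fix Z assume "Z \<in> ?L"
    then have "(Inl -` Z, Inr -` Z) \<in> ?I \<times> ?K"
      using mem[of "Inl -` Z" "Inr -` Z"] unfolding Plus_vimage mem_Times_iff fst_conv snd_conv
      by (rule iffD1[rotated])
    then show "\<exists>p\<in>?I \<times> ?K. Z = (case p of (X, Y) \<Rightarrow> X <+> Y)"
      by (rule rev_bexI) (simp add: Plus_vimage)
  qed
  then have "card ?L = card (?I \<times> ?K)" by (rule bij_betw_same_card[symmetric])
  also have "\<dots> = num_indep \<B> (r - k) * (card F choose k)"
    using F by (simp add: card_cartesian_product num_indep_def n_subsets)
  finally show ?thesis unfolding level_poly_def by simp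
qed

text \<open>By absorption, both sides equal \<open>n * ((n - 1) choose k)\<close>.\<close>

lemma Suc_times_choose_Suc: "Suc k * (n choose Suc k) = (n - k) * (n choose k)"
  by (metis binomial_absorb_comp binomial_absorption)

theorem theorem4p7:
  fixes E :: "'a set" and \<B> :: "'a set set" and r j :: nat
  assumes "matroid E \<B>"
    and "r = matroid_rank \<B>"
    and "infinite {l :: nat. l \<ge> 1 \<and>
           sqrt_BLC (E <+> {..<l})
             (truncation r (direct_sum \<B> (uniform_bases l {..<l}))) l}"
    and "1 \<le> j" and "j \<le> r - 1"
  shows "(num_indep \<B> j)\<^sup>2 \<ge> num_indep \<B> (j - 1) * num_indep \<B> (j + 1)"
proof -
  interpret matroid E \<B> by fact
  define k where "k = r - j"
  \<comment> \<open>Levels run opposite to sizes: level \<open>k - 1\<close> carries the independent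
    sets of size \<open>j + 1\<close>.\<close>
  have k: "1 \<le> k" "k + 1 \<le> r" "r - k = j" "r - (k - 1) = j + 1" "r - (k + 1) = j - 1"
    using assms(4,5) unfolding k_def by auto
  define Q where "Q = (num_indep \<B> j)\<^sup>2"
  define P where "P = num_indep \<B> (j - 1) * num_indep \<B> (j + 1)"
  \<comment> \<open>The term \<open>2 * k\<close> makes the minimum in \<open>sqrt_BLC\<close> equal
    to \<open>k\<close>; the term \<open>Q\<close> ensures \<open>Q \<le> l - k\<close> for the
    final estimate.\<close>
  obtain l where l: "l \<ge> 2 * k + Q + 1"
    and blc: "sqrt_BLC (E <+> {..<l})
      (truncation r (direct_sum \<B> (uniform_bases l {..<l}))) l"
    using assms(3) unfolding finite_nat_set_iff_bounded by (auto simp: not_less)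
  let ?S = "Inr ` {..<l} :: ('a + nat) set"
  let ?L = "\<lambda>i. level_poly (truncation r (direct_sum \<B> {{..<l}})) i ?S (\<lambda>_. 1)"
  have L: "?L i = real (num_indep \<B> (r - i) * (l choose i))" if "i \<le> r" for i
    using level_poly_truncation_direct_sum_free[of "{..<l}" i r] that by simp
  have card_S: "card ?S = l" by (simp add: card_image)
  have "uniform_bases l {..<l} = {{..<l}}"
    using uniform_bases_free[of "{..<l}"] by simp
  moreover have "?S \<subseteq> E <+> {..<l}" by auto
  moreover have "k \<in> {1..l - 1}" using k l by simp
  moreover have "?L k \<noteq> 0"
    using L[of k] num_indep_pos[of j] k l assms(2) by simp
  ultimately have "(?L k)\<^sup>2 > (1 + 1 / real (min k (l - k))) * ?L (k - 1) * ?L (k + 1)"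
    using blc[unfolded sqrt_BLC_def, rule_format, of "\<lambda>_. 1" ?S k] unfolding card_S by simp
  moreover have "min k (l - k) = k" using l by simp
  ultimately have ineq: "(?L k)\<^sup>2 > (1 + 1 / real k) * ?L (k - 1) * ?L (k + 1)" by simp
  define a b c d where "a = real (l choose k)" and "b = real (l choose (k - 1))"
    and "c = real (l choose (k + 1))" and "d = real (l - k)"
  have pos: "a > 0" "d > 0" "real k > 0" using k l unfolding a_def d_def by auto
  have "k * (l choose k) = (l - k + 1) * (l choose (k - 1))"
    using Suc_times_choose_Suc[of "k - 1" l] k l by (simp add: Suc_diff_le)
  from arg_cong[OF this, of real] have "real k * a = (d + 1) * b"
    unfolding a_def b_def d_def by (simp only: of_nat_mult of_nat_add of_nat_1)
  then have b: "b = real k * a / (d + 1)" using pos by (simp add: field_simps)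
  have "(k + 1) * (l choose (k + 1)) = (l - k) * (l choose k)"
    using Suc_times_choose_Suc[of k l] by simp
  from arg_cong[OF this, of real] have "(real k + 1) * c = d * a"
    unfolding a_def c_def d_def by (simp only: of_nat_mult of_nat_add of_nat_1)
  then have c: "c = d * a / (real k + 1)" using pos by (simp add: field_simps)
  have "(?L k)\<^sup>2 = real Q * a\<^sup>2"
    using L[of k] k by (simp add: Q_def a_def power_mult_distrib)
  moreover have "(1 + 1 / real k) * ?L (k - 1) * ?L (k + 1) = (1 + 1 / real k) * (b * c) * real P"
    using L[of "k - 1"] L[of "k + 1"] k by (simp add: P_def b_def c_def)
  \<comment> \<open>The factor \<open>(k + 1) / k\<close> cancels the \<open>k\<close> in
    \<open>b\<close> and the \<open>k + 1\<close> under \<open>c\<close>.\<close>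
  moreover have "(1 + 1 / real k) * (b * c) = d / (d + 1) * a\<^sup>2"
  proof -
    have "(1 + 1 / real k) = (real k + 1) / real k" using pos by (simp add: field_simps)
    then show ?thesis unfolding b c using pos by (simp add: power2_eq_square)
  qed
  ultimately have "d / (d + 1) * a\<^sup>2 * real P < real Q * a\<^sup>2"
    using ineq by (simp only:)
  then have "a\<^sup>2 * (d / (d + 1) * real P) < a\<^sup>2 * real Q" by (simp only: mult_ac)
  then have "d / (d + 1) * real P < real Q"
    by (rule mult_left_less_imp_less) simp
  then have "d * real P < real Q * (d + 1)" using pos by (simp add: field_simps)
  \<comment> \<open>After expansion this is just \<open>Q \<le> d\<close>.\<close>
  also have "\<dots> \<le> d * (real Q + 1)" using l unfolding d_def by (simp add: algebra_simps)
  finally have "real P < real Q + 1" using pos by simp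
  \<comment> \<open>\<open>P\<close> and \<open>Q\<close> are natural numbers, so
    \<open>P < Q + 1\<close> means \<open>P \<le> Q\<close>.\<close>
  then show ?thesis unfolding P_def Q_def by linarith
qed

end
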